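(* Let $V$ be a topological real vector space, let $C\subseteq V$ be a subset and let $f: C\to\mathbb{R}$ be a function. Then the following two assertions are equivalent. (A) All three of the following hold: (i) $C$ is convex and open in $\mathrm{Aff}(C)$; (ii) $f$ is strictly convex and continuous; (iii) for every $x_0\in\mathrm{rb}(C)\subseteq\overline{C}$, $f(x)\to+\infty$ as $x\to x_0$. (B) $\mathrm{Epi}(f)$ is strictly convex (as a subset of $V\times\mathbb{R}$).
   Context: Topological real vector spaces are arbitrary: they need not be Hausdorff and may have any dimension. $V\times\mathbb{R}$ carries the product topology ($\mathbb{R}$ with its usual topology); subsets carry subspace topologies. For a subset $S$ of a real vector space, $\mathrm{Aff}(S)$ is the smallest affine subspace containing $S$ (with $\mathrm{Aff}(\varnothing)=\varnothing$). For a subset $S$ of a topological real vector space, $\mathrm{ri}(S)$, $\mathrm{rc}(S)$ and $\mathrm{rb}(S)$ (relative interior, relative closure, relative boundary) are the interior, closure and boundary of $S$ with respect to the subspace topology of $\mathrm{Aff}(S)$; so $\mathrm{rb}(S)=\mathrm{rc}(S)\setminus\mathrm{ri}(S)$. $\overline{S}$ is the closure of $S$ in the whole space. $[x,y]=\{(1-t)x+ty : t\in[0,1]\}$ and $]x,y[\,=[x,y]\setminus\{x,y\}$. A subset $S$ of a topological real vector space is strictly convex if for any two distinct points $x,y\in\mathrm{rc}(S)$ one has $]x,y[\,\subseteq\mathrm{ri}(S)$. For $f:S\to\mathbb{R}$, $\mathrm{Epi}(f)=\{(x,r)\in S\times\mathbb{R} : f(x)\leq r\}$. A function $f$ on a convex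 set $C$ is strictly convex if $f((1-t)x+ty)<(1-t)f(x)+tf(y)$ for all distinct $x,y\in C$ and all $t\in(0,1)$. For $x_0\in\overline{C}$, "$f(x)\to+\infty$ as $x\to x_0$" means: for every $M\in\mathbb{R}$ there is a neighborhood $N$ of $x_0$ in $V$ with $f(x)\geq M$ for all $x\in N\cap C$. *)

theory Defs
  imports "HOL-Analysis.Analysis"
begin

section \<open>Topological real vector spaces\<close>

text \<open>No separation axiom is imposed, and the dimension is arbitrary.\<close>

class topological_real_vector = real_vector + topological_ab_group_add +
  assumes tendsto_scaleR_Pair:
    "LIM p (nhds c \<times>\<^sub>F nhds x). fst p *\<^sub>R snd p :> nhds (c *\<^sub>R x)"

lemma tendsto_scaleR_topological:
  fixes x :: "'a::topological_real_vector"
  assumes "(f \<longlongrightarrow> c) F" "(g \<longlongrightarrow> x) F"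
  shows "((\<lambda>z. f z *\<^sub>R g z) \<longlongrightarrow> c *\<^sub>R x) F"
  using filterlim_compose[OF tendsto_scaleR_Pair, of "\<lambda>z. (f z, g z)" c x F] assms
  by (simp add: nhds_prod[symmetric] tendsto_Pair)

instance real_normed_vector \<subseteq> topological_real_vector
proof
  fix c :: real and x :: 'a
  have l: "((\<lambda>p. p) \<longlongrightarrow> (c, x)) (nhds (c, x))"
    by (rule filterlim_ident)
  show "LIM p (nhds c \<times>\<^sub>F nhds x). fst p *\<^sub>R snd p :> nhds (c *\<^sub>R x)"
    using tendsto_scaleR[OF tendsto_fst[OF l] tendsto_snd[OF l]] by (simp add: nhds_prod)
qed

instance prod :: (topological_monoid_add, topological_monoid_add) topological_monoid_add
proof
  fix a b :: "'a \<times> 'b"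
  have l: "((\<lambda>p. p) \<longlongrightarrow> (a, b)) (nhds (a, b))"
    by (rule filterlim_ident)
  have "((\<lambda>p. (fst (fst p) + fst (snd p), snd (fst p) + snd (snd p)))
      \<longlongrightarrow> (fst a + fst b, snd a + snd b)) (nhds (a, b))"
    using tendsto_fst[OF l] tendsto_snd[OF l]
    by (intro tendsto_Pair tendsto_add tendsto_fst tendsto_snd) simp_all
  then show "LIM p (nhds a \<times>\<^sub>F nhds b). fst p + snd p :> nhds (a + b)"
    by (simp add: nhds_prod plus_prod_def)
qed

instance prod :: (topological_group_add, topological_group_add) topological_group_add
proof
  fix a :: "'a \<times> 'b"
  have l: "((\<lambda>p. p) \<longlongrightarrow> a) (nhds a)"
    by (rule filterlim_ident)
  have "((\<lambda>p. (- fst p, - snd p)) \<longlongrightarrow> (- fst a, - snd a)) (nhds a)"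
    using l by (intro tendsto_Pair tendsto_minus tendsto_fst tendsto_snd)
  then show "(uminus \<longlongrightarrow> - a) (nhds a)"
    by (simp add: uminus_prod_def[abs_def])
qed

instance prod :: (topological_ab_group_add, topological_ab_group_add) topological_ab_group_add ..

instance prod :: (topological_real_vector, topological_real_vector) topological_real_vector
proof
  fix c :: real and x :: "'a \<times> 'b"
  have l: "((\<lambda>p. p) \<longlongrightarrow> (c, x)) (nhds (c, x))"
    by (rule filterlim_ident)
  have "((\<lambda>p. (fst p *\<^sub>R fst (snd p), fst p *\<^sub>R snd (snd p)))
      \<longlongrightarrow> (c *\<^sub>R fst x, c *\<^sub>R snd x)) (nhds (c, x))"
    using tendsto_fst[OF l] tendsto_snd[OF l]
    by (intro tendsto_Pair tendsto_scaleR_topological tendsto_fst tendsto_snd) simp_all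
  then show "LIM p (nhds c \<times>\<^sub>F nhds x). fst p *\<^sub>R snd p :> nhds (c *\<^sub>R x)"
    by (simp add: nhds_prod scaleR_prod_def)
qed


section \<open>Relative closure and relative boundary\<close>

text \<open>
  The relative interior is the library's \<^const>\<open>rel_interior\<close>. The library's
  \<^const>\<open>rel_frontier\<close> takes the closure in the whole space; this differs from the boundary
  within the affine hull as soon as the latter is not closed.
\<close>

definition rel_closure :: "'a::topological_real_vector set \<Rightarrow> 'a set" where
  "rel_closure S = top_of_set (affine hull S) closure_of S"

definition rel_boundary :: "'a::topological_real_vector set \<Rightarrow> 'a set" where
  "rel_boundary S = top_of_set (affine hull S) frontier_of S"

lemma rel_interior_eq_interior_of:
  "rel_interior S = top_of_set (affine hull S) interior_of S"
  by (simp add: rel_interior_def interior_of_def)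

lemma rel_boundary_eq: "rel_boundary S = rel_closure S - rel_interior S"
  by (simp add: rel_boundary_def rel_closure_def frontier_of_def rel_interior_eq_interior_of)

lemma rel_boundary_subset_closure: "rel_boundary S \<subseteq> closure S"
proof
  fix x assume "x \<in> rel_boundary S"
  then have x: "x \<in> affine hull S"
    and meet: "\<And>T. x \<in> T \<Longrightarrow> openin (top_of_set (affine hull S)) T \<Longrightarrow> \<exists>y\<in>S. y \<in> T"
    by (auto simp: rel_boundary_def frontier_of_def closure_of_def)
  have "S \<inter> U \<noteq> {}" if "open U" "x \<in> U" for U
    using meet[of "affine hull S \<inter> U"] x that by (auto simp: openin_open_Int)
  then show "x \<in> closure S"
    by (meson closure_iff_nhds_not_empty Int_absorb2 subset_refl disjoint_iff subset_iff)
qed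


section \<open>Strict convexity\<close>

definition strictly_convex_set :: "'a::topological_real_vector set \<Rightarrow> bool" where
  "strictly_convex_set S \<longleftrightarrow>
    (\<forall>x\<in>rel_closure S. \<forall>y\<in>rel_closure S. x \<noteq> y \<longrightarrow> open_segment x y \<subseteq> rel_interior S)"

definition strictly_convex_on :: "'a::real_vector set \<Rightarrow> ('a \<Rightarrow> real) \<Rightarrow> bool" where
  "strictly_convex_on C f \<longleftrightarrow> convex C \<and>
    (\<forall>x\<in>C. \<forall>y\<in>C. \<forall>t. x \<noteq> y \<longrightarrow> 0 < t \<longrightarrow> t < 1 \<longrightarrow>
      f ((1 - t) *\<^sub>R x + t *\<^sub>R y) < (1 - t) * f x + t * f y)"


section \<open>Divergence to infinity at a point of the closure\<close>

definition tends_to_infinity_on ::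
    "'a::topological_space set \<Rightarrow> ('a \<Rightarrow> real) \<Rightarrow> 'a \<Rightarrow> bool" where
  "tends_to_infinity_on C f x0 \<longleftrightarrow>
    (\<forall>M. \<exists>N. open N \<and> x0 \<in> N \<and> (\<forall>x\<in>N \<inter> C. M \<le> f x))"

end

theory Submission
  imports Defs
begin

text \<open>
  The affine hull of the epigraph is \<open>Aff(C) \<times> \<real>\<close>, so vertical segments never leave it. Hence a
  point is in the relative interior of the epigraph iff \<open>f\<close> is bounded near it, on an
  \<open>Aff(C)\<close>-neighbourhood contained in \<open>C\<close>, by something strictly below its height. Strict convexity
  applied to vertical segments over \<open>C\<close> gives that \<open>C\<close> is relatively open and \<open>f\<close> upper
  semicontinuous (lower semicontinuity follows by reflecting at the point and midpoint
  convexity); applied to vertical segments over a boundary point it excludes that \<open>f\<close> stays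
  below a constant arbitrarily close to that point. Conversely, divergence at the boundary makes
  the epigraph relatively closed, and strict convexity of \<open>f\<close> together with continuity puts open
  segments in the relative interior.
\<close>

section \<open>Relative topology of the epigraph\<close>

text \<open>Since \<open>S\<close> lies in its affine hull, closing it there gives the trace of its
  closure, so open sets of the whole space suffice as tests.\<close>

lemma mem_rel_closure:
  "x \<in> rel_closure S \<longleftrightarrow>
    x \<in> affine hull S \<and> (\<forall>U. open U \<longrightarrow> x \<in> U \<longrightarrow> (\<exists>y\<in>S. y \<in> U))"
proof -
  have "affine hull S \<inter> S = S"
    using hull_subset[of S affine] by blast
  then have "x \<in> rel_closure S \<longleftrightarrow> x \<in> affine hull S \<and> x \<in> closure S"
    by (simp add: rel_closure_def closure_of_subtopology)
  also have "x \<in> closure S \<longleftrightarrow> (\<forall>U. open U \<longrightarrow> x \<in> U \<longrightarrow> (\<exists>y\<in>S. y \<in> U))"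
    unfolding euclidean_closure_of[symmetric] by (auto simp: closure_of_def)
  finally show ?thesis .
qed

text \<open>The points whose whole vertical line lies in the hull form an affine set
  \<open>?A\<close>. It contains \<open>C\<close>, because \<open>(x, f x)\<close> and
  \<open>(x, f x + 1)\<close> already span the line over \<open>x\<close>.\<close>

lemma affine_hull_epigraph:
  fixes f :: "'a::real_vector \<Rightarrow> real"
  shows "affine hull (epigraph C f) = (affine hull C) \<times> UNIV"
proof
  have "affine ((affine hull C) \<times> (UNIV :: real set))"
    by (auto simp: affine_def intro: mem_affine[OF affine_affine_hull])
  moreover have "epigraph C f \<subseteq> (affine hull C) \<times> UNIV"
    by (auto simp: epigraph_def hull_inc)
  ultimately show "affine hull (epigraph C f) \<subseteq> (affine hull C) \<times> UNIV"
    by (simp add: hull_minimal)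
next
  let ?H = "affine hull (epigraph C f)"
  let ?A = "{x. \<forall>r. (x, r) \<in> ?H}"
  have "affine ?A"
  proof (rule affine_def[THEN iffD2], intro ballI allI impI CollectI)
    fix x y :: 'a and u v r :: real
    assume xy: "x \<in> ?A" "y \<in> ?A" and uv: "u + v = 1"
    then have "u *\<^sub>R (x, r) + v *\<^sub>R (y, r) \<in> ?H"
      by (intro mem_affine[OF affine_affine_hull]) auto
    moreover have "u * r + v * r = r"
      using uv by (metis distrib_right mult_1)
    ultimately show "(u *\<^sub>R x + v *\<^sub>R y, r) \<in> ?H"
      by simp
  qed
  moreover have "C \<subseteq> ?A"
  proof (intro subsetI CollectI allI)
    fix x r assume "x \<in> C"
    then have "(x, f x) \<in> ?H" "(x, f x + 1) \<in> ?H"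
      by (auto simp: mem_epigraph hull_inc)
    then have "(x, f x) + (r - f x) *\<^sub>R ((x, f x + 1) - (x, f x)) \<in> ?H"
      by (intro mem_affine_3_minus) auto
    then show "(x, r) \<in> ?H"
      by simp
  qed
  ultimately have "affine hull C \<subseteq> ?A"
    by (rule hull_minimal[rotated])
  then show "(affine hull C) \<times> UNIV \<subseteq> ?H"
    by auto
qed

text \<open>A box around \<open>(x, r)\<close> whose trace on the hull lies in the epigraph reaches
  down to a height \<open>s < r\<close>, which bounds \<open>f\<close> over the base. Conversely,
  \<open>N \<times> {s<..}\<close> is a suitable open box.\<close>

lemma mem_rel_interior_epigraph:
  fixes f :: "'a::topological_real_vector \<Rightarrow> real"
  shows "(x, r) \<in> rel_interior (epigraph C f) \<longleftrightarrow>
    x \<in> affine hull C \<and>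
    (\<exists>s<r. \<exists>N. open N \<and> x \<in> N \<and> (\<forall>y\<in>N \<inter> affine hull C. y \<in> C \<and> f y \<le> s))"
    (is "?L \<longleftrightarrow> ?R")
proof
  assume ?L
  then obtain T where T: "open T" "(x, r) \<in> T" "x \<in> C"
    and sub: "T \<inter> ((affine hull C) \<times> UNIV) \<subseteq> epigraph C f"
    by (auto simp: mem_rel_interior affine_hull_epigraph mem_epigraph)
  obtain N I where NI: "open N" "open I" "x \<in> N" "r \<in> I" "N \<times> I \<subseteq> T"
    using open_prod_elim[OF T(1,2)] by (metis mem_Sigma_iff)
  obtain e where e: "e > 0" "ball r e \<subseteq> I"
    using NI openE by blast
  then have "r - e / 2 \<in> I"
    by (auto simp: subset_iff dist_real_def)
  then have "(y, r - e / 2) \<in> epigraph C f" if "y \<in> N \<inter> affine hull C" for y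
    using NI(5) sub that by blast
  then have "\<forall>y\<in>N \<inter> affine hull C. y \<in> C \<and> f y \<le> r - e / 2"
    by (simp add: mem_epigraph)
  moreover have "r - e / 2 < r"
    using e by simp
  ultimately show ?R
    using NI T(3) hull_inc by metis
next
  assume ?R
  then obtain s N where sN: "x \<in> affine hull C" "s < r" "open N" "x \<in> N"
    and N: "\<And>y. y \<in> N \<Longrightarrow> y \<in> affine hull C \<Longrightarrow> y \<in> C \<and> f y \<le> s"
    by blast
  have "open (N \<times> {s<..})"
    using sN by (simp add: open_Times)
  moreover have "(x, r) \<in> N \<times> {s<..} \<inter> epigraph C f"
    using sN N[of x] by (auto simp: mem_epigraph)
  moreover have "N \<times> {s<..} \<inter> affine hull (epigraph C f) \<subseteq> epigraph C f"
    using N by (force simp: affine_hull_epigraph mem_epigraph)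
  ultimately show ?L
    unfolding mem_rel_interior by blast
qed

text \<open>The epigraph is closed upwards, so only the upper end of an interval around
  \<open>r\<close> imposes a condition on \<open>f\<close>.\<close>

lemma mem_rel_closure_epigraph:
  fixes f :: "'a::topological_real_vector \<Rightarrow> real"
  shows "(x, r) \<in> rel_closure (epigraph C f) \<longleftrightarrow>
    x \<in> affine hull C \<and>
    (\<forall>s>r. \<forall>N. open N \<longrightarrow> x \<in> N \<longrightarrow> (\<exists>y\<in>N \<inter> C. f y < s))"
    (is "?L \<longleftrightarrow> ?R")
proof
  assume L: ?L
  have "\<exists>y\<in>N \<inter> C. f y < s" if "s > r" "open N" "x \<in> N" for s N
  proof -
    have "open (N \<times> {..<s})" "(x, r) \<in> N \<times> {..<s}"
      using that by (auto simp: open_Times)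
    then obtain p where "p \<in> epigraph C f" "p \<in> N \<times> {..<s}"
      using L unfolding mem_rel_closure by blast
    then show ?thesis
      by (force simp: epigraph_def)
  qed
  then show ?R
    using L by (auto simp: mem_rel_closure affine_hull_epigraph)
next
  assume R: ?R
  have "\<exists>p\<in>epigraph C f. p \<in> U" if U: "open U" "(x, r) \<in> U" for U
  proof -
    obtain N I where NI: "open N" "open I" "x \<in> N" "r \<in> I" "N \<times> I \<subseteq> U"
      using open_prod_elim[OF U] by (metis mem_Sigma_iff)
    obtain e where e: "e > 0" "ball r e \<subseteq> I"
      using NI openE by blast
    obtain y where y: "y \<in> N" "y \<in> C" "f y < r + e"
      using R NI e by (metis IntE less_add_same_cancel1)
    \<comment> \<open>Raising the height to at least \<open>r\<close> stays above the graph and, as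
      \<open>f y < r + e\<close>, within \<open>e\<close> of \<open>r\<close>.\<close>
    then have "max (f y) r \<in> I"
      using e by (auto simp: subset_iff dist_real_def)
    then have "(y, max (f y) r) \<in> U" "(y, max (f y) r) \<in> epigraph C f"
      using NI y by (auto simp: mem_epigraph)
    then show ?thesis by blast
  qed
  then show ?L
    using R by (auto simp: mem_rel_closure affine_hull_epigraph)
qed

lemma openin_affine_hull_iff_rel_interior:
  "openin (top_of_set (affine hull C)) C \<longleftrightarrow> rel_interior C = C"
  by (metis rel_open rel_open_def)

lemma mem_rel_boundary_of_open:
  assumes "openin (top_of_set (affine hull C)) C"
  shows "x \<in> rel_boundary C \<longleftrightarrow> x \<in> rel_closure C \<and> x \<notin> C"
  using assms by (simp add: rel_boundary_eq openin_affine_hull_iff_rel_interior)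

lemma epigraph_subset_rel_closure:
  fixes f :: "'a::topological_real_vector \<Rightarrow> real"
  shows "epigraph C f \<subseteq> rel_closure (epigraph C f)"
  by (auto simp: mem_rel_closure hull_inc)

section \<open>From conditions on the function to the epigraph\<close>

text \<open>Near a limit point \<open>(x, r)\<close>, \<open>f\<close> takes values below every
  \<open>s > r\<close>. Divergence then rules out \<open>x \<notin> C\<close>, and continuity at
  \<open>x\<close> rules out \<open>f x > r\<close>.\<close>

lemma rel_closure_epigraph_eq:
  fixes f :: "'a::topological_real_vector \<Rightarrow> real"
  assumes op: "openin (top_of_set (affine hull C)) C"
    and cont: "continuous_on C f"
    and inf: "\<forall>x\<in>rel_boundary C. tends_to_infinity_on C f x"
  shows "rel_closure (epigraph C f) = epigraph C f"
proof
  show "rel_closure (epigraph C f) \<subseteq> epigraph C f"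
  proof clarify
    fix x r assume "(x, r) \<in> rel_closure (epigraph C f)"
    then have x: "x \<in> affine hull C"
      and low: "\<And>s N. s > r \<Longrightarrow> open N \<Longrightarrow> x \<in> N \<Longrightarrow> \<exists>y\<in>N \<inter> C. f y < s"
      by (auto simp: mem_rel_closure_epigraph)
    have "x \<in> C"
    proof (rule ccontr)
      assume "x \<notin> C"
      moreover have "x \<in> rel_closure C"
        using x low[of "r + 1"] by (fastforce simp: mem_rel_closure)
      ultimately have "tends_to_infinity_on C f x"
        using inf op by (simp add: mem_rel_boundary_of_open)
      then obtain N where "open N" "x \<in> N" "\<forall>y\<in>N \<inter> C. r + 1 \<le> f y"
        unfolding tends_to_infinity_on_def by blast
      then show False
        using low[of "r + 1" N] by force
    qed
    moreover have "f x \<le> r"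
    proof (rule ccontr)
      assume "\<not> f x \<le> r"
      then obtain s where s: "r < s" "s < f x"
        using dense by (metis not_le)
      then obtain N where "open N" "x \<in> N" "\<forall>y\<in>C. y \<in> N \<longrightarrow> f y \<in> {s<..}"
        using cont \<open>x \<in> C\<close> unfolding continuous_on_topological
        by (metis open_greaterThan greaterThan_iff)
      then show False
        using low[of s N] s by force
    qed
    ultimately show "(x, r) \<in> epigraph C f"
      by (simp add: mem_epigraph)
  qed
qed (rule epigraph_subset_rel_closure)

lemma mem_rel_interior_epigraph_of_continuous:
  fixes f :: "'a::topological_real_vector \<Rightarrow> real"
  assumes op: "openin (top_of_set (affine hull C)) C"
    and cont: "continuous_on C f"
    and x: "x \<in> C" "f x < r"
  shows "(x, r) \<in> rel_interior (epigraph C f)"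
proof -
  obtain s where s: "f x < s" "s < r"
    using dense x by blast
  then obtain N where N: "open N" "x \<in> N" "\<forall>y\<in>C. y \<in> N \<longrightarrow> f y \<in> {..<s}"
    using cont x unfolding continuous_on_topological
    by (metis open_lessThan lessThan_iff)
  \<comment> \<open>Intersecting with \<open>T\<close> turns the bound on
    \<open>N \<inter> C\<close> into one on a neighbourhood within the affine hull.\<close>
  obtain T where T: "open T" "C = affine hull C \<inter> T"
    using op unfolding openin_open by blast
  have "open (N \<inter> T)" "x \<in> N \<inter> T" "x \<in> affine hull C"
    using N T x by (auto simp: open_Int hull_inc)
  moreover have "\<forall>y\<in>(N \<inter> T) \<inter> affine hull C. y \<in> C \<and> f y \<le> s"
    using N T by force
  ultimately show ?thesis
    unfolding mem_rel_interior_epigraph using s by blast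
qed

text \<open>The epigraph is relatively closed, so both endpoints lie in it, and it is enough that
  inner points of the segment lie strictly above the graph.\<close>

lemma strictly_convex_epigraph:
  fixes f :: "'a::topological_real_vector \<Rightarrow> real"
  assumes op: "openin (top_of_set (affine hull C)) C"
    and conv: "strictly_convex_on C f"
    and cont: "continuous_on C f"
    and inf: "\<forall>x\<in>rel_boundary C. tends_to_infinity_on C f x"
  shows "strictly_convex_set (epigraph C f)"
  unfolding strictly_convex_set_def rel_closure_epigraph_eq[OF op cont inf]
proof (intro ballI impI subsetI)
  fix p q z
  assume p: "p \<in> epigraph C f" and q: "q \<in> epigraph C f" and "p \<noteq> q"
    and "z \<in> open_segment p q"
  then obtain t where t: "0 < t" "t < 1" and z: "z = (1 - t) *\<^sub>R p + t *\<^sub>R q"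
    by (auto simp: in_segment)
  obtain x r y s where pq: "p = (x, r)" "q = (y, s)"
    by (metis surj_pair)
  have xy: "x \<in> C" "f x \<le> r" "y \<in> C" "f y \<le> s"
    using p q pq by (auto simp: mem_epigraph)
  have le: "(1 - t) * f x + t * f y \<le> (1 - t) * r + t * s"
    using xy t by (intro add_mono mult_left_mono) auto
  have "f ((1 - t) *\<^sub>R x + t *\<^sub>R y) < (1 - t) * r + t * s"
  proof (cases "x = y")
    case False
    then have "f ((1 - t) *\<^sub>R x + t *\<^sub>R y) < (1 - t) * f x + t * f y"
      using conv xy t unfolding strictly_convex_on_def by blast
    then show ?thesis
      using le by simp
  next
    \<comment> \<open>On a vertical segment the strictness comes from the heights: two distinct
      points over \<open>x\<close> cannot both have height \<open>f x\<close>.\<close>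
    case True
    then have "f x < r \<or> f x < s"
      using \<open>p \<noteq> q\<close> pq xy by auto
    then have "0 < (1 - t) * (r - f x) + t * (s - f x)"
      using t xy True
      by (elim disjE) (simp_all add: add_pos_nonneg add_nonneg_pos)
    then show ?thesis
      using True by (simp add: algebra_simps)
  qed
  moreover have "(1 - t) *\<^sub>R x + t *\<^sub>R y \<in> C"
    using conv xy t unfolding strictly_convex_on_def convex_def by auto
  ultimately show "z \<in> rel_interior (epigraph C f)"
    using mem_rel_interior_epigraph_of_continuous[OF op cont] z pq by simp
qed

section \<open>From strict convexity of the epigraph to conditions on the function\<close>

text \<open>The lower bound comes from the upper one by reflection: \<open>x\<close> is the midpoint
  of \<open>y\<close> and \<open>x + x - y\<close>, so
  \<open>f y \<ge> 2 * f x - f (x + x - y) > f x - e\<close>.\<close>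

lemma continuous_on_if_midpoint_convex_upper_semicontinuous:
  fixes f :: "'a::topological_real_vector \<Rightarrow> real"
  assumes mid: "\<And>x y. x \<in> C \<Longrightarrow> y \<in> C \<Longrightarrow>
      f ((1/2) *\<^sub>R x + (1/2) *\<^sub>R y) \<le> (f x + f y) / 2"
    and usc: "\<And>x r. x \<in> C \<Longrightarrow> f x < r \<Longrightarrow>
      \<exists>N. open N \<and> x \<in> N \<and> (\<forall>y\<in>N \<inter> affine hull C. y \<in> C \<and> f y < r)"
  shows "continuous_on C f"
  unfolding continuous_on_topological
proof (intro ballI allI impI)
  fix x B assume x: "x \<in> C" and B: "open B" "f x \<in> B"
  then obtain e where e: "e > 0" "ball (f x) e \<subseteq> B"
    using openE by blast
  then obtain N where N: "open N" "x \<in> N"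
    and bound: "\<And>y. y \<in> N \<Longrightarrow> y \<in> affine hull C \<Longrightarrow> y \<in> C \<and> f y < f x + e"
    using usc[OF x, of "f x + e"] by (metis IntI less_add_same_cancel1)
  let ?refl = "\<lambda>y. x + x - y"
  have "open (?refl -` N)"
    using N(1) by (intro open_vimage continuous_intros)
  then have "open (N \<inter> ?refl -` N)" "x \<in> N \<inter> ?refl -` N"
    using N by (auto simp: open_Int)
  moreover have "f y \<in> B" if "y \<in> C" "y \<in> N \<inter> ?refl -` N" for y
  proof -
    have "x \<in> affine hull C" "y \<in> affine hull C"
      using x that by (auto simp: hull_inc)
    \<comment> \<open>The neighbourhood \<open>N\<close> meets the affine hull inside
      \<open>C\<close>, so a reflected point in the hull is again in the domain.\<close>
    then have "?refl y \<in> affine hull C"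
      using mem_affine_3_minus[of "affine hull C" x x y 1] by (simp add: algebra_simps)
    then have r: "?refl y \<in> C" "f (?refl y) < f x + e"
      using bound that by auto
    have "(1/2) *\<^sub>R y + (1/2) *\<^sub>R ?refl y = x"
      by (simp flip: scaleR_add_right scaleR_2)
    then have "f x \<le> (f y + f (?refl y)) / 2"
      using mid[OF that(1) r(1)] by simp
    moreover have "f y < f x + e"
      using bound that by (auto simp: hull_inc)
    ultimately have "f y \<in> ball (f x) e"
      using r by (simp add: dist_real_def abs_less_iff)
    then show ?thesis
      using e by blast
  qed
  ultimately show "\<exists>A. open A \<and> x \<in> A \<and> (\<forall>y\<in>C. y \<in> A \<longrightarrow> f y \<in> B)"
    by blast
qed

context
  fixes C :: "'a::topological_real_vector set" and f :: "'a \<Rightarrow> real"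
  assumes sc: "strictly_convex_set (epigraph C f)"
begin

lemma segment_in_rel_interior_epigraph:
  assumes "(x, r) \<in> rel_closure (epigraph C f)" "(y, s) \<in> rel_closure (epigraph C f)"
    and "(x, r) \<noteq> (y, s)" "0 < t" "t < 1"
  shows "((1 - t) *\<^sub>R x + t *\<^sub>R y, (1 - t) * r + t * s) \<in> rel_interior (epigraph C f)"
proof -
  have "(1 - t) *\<^sub>R (x, r) + t *\<^sub>R (y, s) \<in> open_segment (x, r) (y, s)"
    using assms by (auto simp: in_segment)
  then have "(1 - t) *\<^sub>R (x, r) + t *\<^sub>R (y, s) \<in> rel_interior (epigraph C f)"
    using sc assms unfolding strictly_convex_set_def by blast
  then show ?thesis
    by simp
qed

text \<open>Strict convexity is applied to a vertical segment with midpoint \<open>(x, s)\<close>.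
  The point \<open>x\<close> may lie outside \<open>C\<close>, which is the case at the relative
  boundary.\<close>

lemma vertical_in_rel_interior_epigraph:
  assumes "(x, r) \<in> rel_closure (epigraph C f)" "r < s"
  shows "(x, s) \<in> rel_interior (epigraph C f)"
proof -
  \<comment> \<open>The upper endpoint is the reflection of \<open>(x, r)\<close> at height
    \<open>s\<close>.\<close>
  have "(x, r + 2 * (s - r)) \<in> rel_closure (epigraph C f)"
    using assms by (auto simp: mem_rel_closure_epigraph)
  from segment_in_rel_interior_epigraph[OF assms(1) this, of "1/2"] assms(2)
  have "((1/2) *\<^sub>R x + (1/2) *\<^sub>R x, (1/2) * r + (1/2) * (r + 2 * (s - r)))
      \<in> rel_interior (epigraph C f)"
    by simp
  moreover have "(1/2) *\<^sub>R x + (1/2) *\<^sub>R x = x"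
    by (simp flip: scaleR_add_left)
  moreover have "(1/2) * r + (1/2) * (r + 2 * (s - r)) = s"
    by (simp add: field_simps)
  ultimately show ?thesis
    by metis
qed

text \<open>Going up from the graph point \<open>(x, f x)\<close> yields relative openness of
  \<open>C\<close> and upper semicontinuity of \<open>f\<close> at once.\<close>

lemma bounded_above_near_if_strictly_convex_epigraph:
  assumes "x \<in> C" "f x < r"
  shows "\<exists>N. open N \<and> x \<in> N \<and> (\<forall>y\<in>N \<inter> affine hull C. y \<in> C \<and> f y < r)"
proof -
  have "(x, f x) \<in> rel_closure (epigraph C f)"
    using assms epigraph_subset_rel_closure by (metis mem_epigraph order_refl subsetD)
  then have "(x, r) \<in> rel_interior (epigraph C f)"
    using assms by (rule_tac vertical_in_rel_interior_epigraph)
  then show ?thesis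
    unfolding mem_rel_interior_epigraph by (metis order_le_less_trans)
qed

lemma open_if_strictly_convex_epigraph: "openin (top_of_set (affine hull C)) C"
proof -
  have "x \<in> rel_interior C" if x: "x \<in> C" for x
    using bounded_above_near_if_strictly_convex_epigraph[OF x, of "f x + 1"] x
    by (auto simp: mem_rel_interior subset_iff)
  then show ?thesis
    unfolding openin_affine_hull_iff_rel_interior by (auto simp: mem_rel_interior)
qed

lemma strictly_convex_on_if_strictly_convex_epigraph: "strictly_convex_on C f"
proof -
  have *: "(1 - t) *\<^sub>R x + t *\<^sub>R y \<in> C \<and>
      f ((1 - t) *\<^sub>R x + t *\<^sub>R y) < (1 - t) * f x + t * f y"
    if "x \<in> C" "y \<in> C" "x \<noteq> y" "0 < t" "t < 1" for x y t
  proof -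
    have "(x, f x) \<in> rel_closure (epigraph C f)" "(y, f y) \<in> rel_closure (epigraph C f)"
      using that epigraph_subset_rel_closure by (metis mem_epigraph order_refl subsetD)+
    \<comment> \<open>The bound \<open>s\<close> strictly below the height of an interior point
      makes the inequality strict; the base point is in \<open>C\<close> because it lies in
      \<open>N\<close> and in the hull.\<close>
    from segment_in_rel_interior_epigraph[OF this, of t] that show ?thesis
      unfolding mem_rel_interior_epigraph by force
  qed
  have "convex C"
    unfolding convex_contains_open_segment by (auto simp: in_segment *)
  with * show ?thesis
    unfolding strictly_convex_on_def by blast
qed

lemma continuous_on_if_strictly_convex_epigraph: "continuous_on C f"
proof (rule continuous_on_if_midpoint_convex_upper_semicontinuous)
  fix x y assume "x \<in> C" "y \<in> C"
  then show "f ((1/2) *\<^sub>R x + (1/2) *\<^sub>R y) \<le> (f x + f y) / 2"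
  proof (cases "x = y")
    case True
    then show ?thesis by (simp flip: scaleR_add_left)
  next
    case False
    then have "f ((1 - 1/2) *\<^sub>R x + (1/2) *\<^sub>R y) < (1 - 1/2) * f x + (1/2) * f y"
      using strictly_convex_on_if_strictly_convex_epigraph \<open>x \<in> C\<close> \<open>y \<in> C\<close>
      unfolding strictly_convex_on_def
      by (elim conjE) (drule (1) bspec, drule (1) bspec, drule_tac x = "1/2" in spec, simp)
    then show ?thesis by simp
  qed
qed (rule bounded_above_near_if_strictly_convex_epigraph)

text \<open>If \<open>f\<close> took values below \<open>M\<close> arbitrarily near
  \<open>x\<close>, then \<open>(x, M)\<close> would be a limit point and \<open>(x, M + 1)\<close>
  would lie in the epigraph, forcing \<open>x \<in> C\<close>.\<close>

lemma tends_to_infinity_if_strictly_convex_epigraph: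
  assumes "x \<in> rel_boundary C"
  shows "tends_to_infinity_on C f x"
proof (rule ccontr)
  have x: "x \<in> affine hull C" "x \<notin> C"
    using assms open_if_strictly_convex_epigraph
    by (auto simp: mem_rel_boundary_of_open mem_rel_closure)
  assume "\<not> tends_to_infinity_on C f x"
  then obtain M where "\<And>N. open N \<Longrightarrow> x \<in> N \<Longrightarrow> \<exists>y\<in>N \<inter> C. f y < M"
    unfolding tends_to_infinity_on_def by (metis not_le)
  then have "(x, M) \<in> rel_closure (epigraph C f)"
    unfolding mem_rel_closure_epigraph using x(1) by (meson order_less_trans)
  then have "(x, M + 1) \<in> rel_interior (epigraph C f)"
    by (rule vertical_in_rel_interior_epigraph) simp
  then show False
    using x by (auto simp: mem_rel_interior mem_epigraph)
qed

end

theorem mainTheorem1: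
  fixes C :: "'v::topological_real_vector set" and f :: "'v \<Rightarrow> real"
  shows
    "((convex C \<and> openin (top_of_set (affine hull C)) C) \<and>
      (strictly_convex_on C f \<and> continuous_on C f) \<and>
      (\<forall>x0\<in>rel_boundary C. tends_to_infinity_on C f x0))
     \<longleftrightarrow> strictly_convex_set (epigraph C f)"
proof
  assume "strictly_convex_set (epigraph C f)"
  note B = open_if_strictly_convex_epigraph[OF this]
    strictly_convex_on_if_strictly_convex_epigraph[OF this]
    continuous_on_if_strictly_convex_epigraph[OF this]
    tends_to_infinity_if_strictly_convex_epigraph[OF this]
  moreover have "convex C"
    using B(2) by (simp add: strictly_convex_on_def)
  ultimately show "(convex C \<and> openin (top_of_set (affine hull C)) C) \<and>
      (strictly_convex_on C f \<and> continuous_on C f) \<and>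
      (\<forall>x0\<in>rel_boundary C. tends_to_infinity_on C f x0)"
    by (intro conjI ballI)
qed (elim conjE, rule strictly_convex_epigraph)

end
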